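(* For integers $n\ge2$ and $s\ge2$, \[ \begin{split} &\sum_{i = 2}^{n-1} \binom{n+s-i-1}{s-1}\sum_{\mu = 1}^\infty \frac{H_{\mu ,i} }{\mu ^{n + s - i} } + \sum_{i = 2}^{s-1} \binom{n+s-i-1}{n-1}\sum_{\mu = 1}^\infty \frac{H_{\mu ,i} }{\mu ^{n + s - i} }\\ &\qquad=\zeta (n + s)\left[ \binom{n+s}n-(n+s+1)\binom{n+s-2}{s-1}-1\right] +\binom{n+s-2}{s-1}\sum_{i=2}^{n+s-2}\zeta(i)\zeta(n+s-i). \end{split} \]
   Context: $H_{\mu,i}=\sum_{k=1}^\mu k^{-i}$ is a generalized harmonic number and $\zeta$ is the Riemann zeta function. Empty sums are zero. *)

theory Defs
  imports "HOL-Analysis.Analysis"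
begin

definition gen_harm :: "nat \<Rightarrow> nat \<Rightarrow> real" where
  "gen_harm m i = (\<Sum>k=1..m. 1 / real k ^ i)"

(* The Riemann zeta function at integer arguments k >= 2, given by its Dirichlet series;
   the value is only meaningful there (for k <= 1 the series diverges). *)
definition zeta :: "nat \<Rightarrow> real" where
  "zeta k = (\<Sum>m. 1 / real (Suc m) ^ k)"

(* sum of H_{mu,i} / mu^q over mu >= 1, with mu = Suc m; convergent for i, q >= 2 *)
definition euler_sum :: "nat \<Rightarrow> nat \<Rightarrow> real" where
  "euler_sum i q = (\<Sum>m. gen_harm (Suc m) i / real (Suc m) ^ q)"

end

theory Submission
  imports Defs
begin

text \<open>
  Put $T(j, q) = \sum_{a, b \ge 1} a^{-j} (a + b)^{-q}$; grouping by $\mu = a + b$ shows that $T(j, q)$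
  is the Euler sum of $H_{\mu,j} / \mu^q$ minus $\zeta(j + q)$. Expanding $a^{-n} b^{-s}$ into partial
  fractions with denominators $a^i (a + b)^{n+s-i}$ and $b^i (a + b)^{n+s-i}$ and summing over $a, b$
  expresses $\zeta(n) \zeta(s)$ through the $T(i, n + s - i)$. The extreme terms are removed with
  two classical identities: the terms $i = n$ and $i = s$ by the reflection formula, the terms
  $i = 1$ by Euler's evaluation of the sum of $H_{\mu,1} / \mu^q$.
\<close>

section \<open>Unconditional sums, the zeta series and products of zeta values\<close>

lemma has_sum_finite_sum:
  fixes f :: "'a \<Rightarrow> 'b \<Rightarrow> 'c :: topological_comm_monoid_add"
  assumes "\<And>i. i \<in> I \<Longrightarrow> (f i has_sum S i) A"
  shows "((\<lambda>x. \<Sum>i\<in>I. f i x) has_sum (\<Sum>i\<in>I. S i)) A"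
  using assms by (induction I rule: infinite_finite_induct) (auto intro: has_sum_add has_sum_0)

lemma has_sum_diff:
  fixes f g :: "'a \<Rightarrow> 'b :: topological_ab_group_add"
  assumes "(f has_sum a) A" "(g has_sum b) A"
  shows "((\<lambda>x. f x - g x) has_sum a - b) A"
  using has_sum_add[OF assms(1), of "\<lambda>x. - g x" "- b"] assms(2) by (simp add: has_sum_uminus)

lemma has_sum_UNIV_swap:
  assumes "((\<lambda>(a, b). f a b) has_sum S) UNIV"
  shows "((\<lambda>(a, b). f b a) has_sum S) UNIV"
  using assms has_sum_swap[where f = "\<lambda>(a, b). f a b" and A = UNIV and B = UNIV and S = S] by simp

lemma has_sum_zeta:
  assumes "k \<ge> 2"
  shows "((\<lambda>m. 1 / real (Suc m) ^ k) has_sum zeta k) UNIV"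
proof (rule sums_nonneg_imp_has_sum)
  have "summable (\<lambda>m. inverse (real m ^ k))"
    using inverse_power_summable[OF assms, where 'a = real] by simp
  hence "summable (\<lambda>m. 1 / real (Suc m) ^ k)"
    by (subst (asm) summable_Suc_iff[symmetric]) (simp add: inverse_eq_divide)
  thus "(\<lambda>m. 1 / real (Suc m) ^ k) sums zeta k"
    unfolding zeta_def by (rule summable_sums)
qed simp

lemma summable_on_prod_inverse_powers:
  assumes "k \<ge> 2" "l \<ge> 2"
  shows "(\<lambda>(a, b). 1 / (real (Suc a) ^ k * real (Suc b) ^ l)) summable_on UNIV"
proof -
  have "(\<lambda>(a, b). 1 / (real (Suc a) ^ k * real (Suc b) ^ l)) summable_on UNIV \<times> UNIV"
  proof (rule summable_on_SigmaI)
    show "((\<lambda>b. case (a, b) of (a, b) \<Rightarrow> 1 / (real (Suc a) ^ k * real (Suc b) ^ l)) has_sum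
        1 / real (Suc a) ^ k * zeta l) UNIV" for a
      using has_sum_cmult_right[OF has_sum_zeta[OF assms(2)], of "1 / real (Suc a) ^ k"] by simp
    show "(\<lambda>a. 1 / real (Suc a) ^ k * zeta l) summable_on UNIV"
      using has_sum_cmult_left[OF has_sum_zeta[OF assms(1)]] has_sum_imp_summable by blast
  qed auto
  thus ?thesis by simp
qed

lemma has_sum_zeta_mult:
  assumes "k \<ge> 2" "l \<ge> 2"
  shows "((\<lambda>(a, b). 1 / (real (Suc a) ^ k * real (Suc b) ^ l)) has_sum zeta k * zeta l) UNIV"
proof -
  have "((\<lambda>(a, b). 1 / (real (Suc a) ^ k * real (Suc b) ^ l)) has_sum zeta k * zeta l) (UNIV \<times> UNIV)"
  proof (rule has_sum_SigmaI)
    show "((\<lambda>b. case (a, b) of (a, b) \<Rightarrow> 1 / (real (Suc a) ^ k * real (Suc b) ^ l)) has_sum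
        1 / real (Suc a) ^ k * zeta l) UNIV" for a
      using has_sum_cmult_right[OF has_sum_zeta[OF assms(2)], of "1 / real (Suc a) ^ k"] by simp
    show "((\<lambda>a. 1 / real (Suc a) ^ k * zeta l) has_sum zeta k * zeta l) UNIV"
      by (rule has_sum_cmult_left[OF has_sum_zeta[OF assms(1)]])
  qed (use summable_on_prod_inverse_powers[OF assms] in simp)
  thus ?thesis by simp
qed

section \<open>Harmonic numbers and Tornheim double series\<close>

lemma gen_harm_Suc: "gen_harm (Suc m) i = gen_harm m i + 1 / real (Suc m) ^ i"
  by (simp add: gen_harm_def)

lemma gen_harm_lessThan: "gen_harm m i = (\<Sum>k<m. 1 / real (Suc k) ^ i)"
  by (induction m) (simp_all add: gen_harm_Suc, simp add: gen_harm_def)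

text \<open>Comparison with the product series of exponents 2 and 2. For \<open>j = 1\<close> the
  missing second factor \<open>x\<close> is bounded by \<open>x + y\<close>, which costs a third
  power of \<open>x + y\<close>; the bound \<open>j + q \<ge> 4\<close> supplies it.\<close>

lemma summable_on_Tornheim:
  assumes "j \<ge> 1" "q \<ge> 2" "j + q \<ge> 4"
  shows "(\<lambda>(a, b). 1 / (real (Suc a) ^ j * (real (Suc a) + real (Suc b)) ^ q)) summable_on UNIV"
proof (rule summable_on_comparison_test[OF summable_on_prod_inverse_powers[of 2 2]])
  fix p :: "nat \<times> nat"
  obtain a b where p: "p = (a, b)" by fastforce
  define x y where "x = real (Suc a)" and "y = real (Suc b)"
  have xy: "x \<ge> 1" "y \<ge> 1" by (simp_all add: x_def y_def)
  have "x\<^sup>2 * y\<^sup>2 \<le> x ^ j * (x + y) ^ q"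
  proof (cases "j = 1")
    case True
    have "x\<^sup>2 * y\<^sup>2 = x * (x * y\<^sup>2)" by (simp add: power2_eq_square)
    also have "\<dots> \<le> x * ((x + y) * (x + y)\<^sup>2)"
      using xy by (intro mult_left_mono mult_mono power_mono) auto
    also have "\<dots> = x * (x + y) ^ 3" by (simp add: power2_eq_square power3_eq_cube)
    also have "\<dots> \<le> x * (x + y) ^ q"
      using xy assms True by (intro mult_left_mono power_increasing) auto
    finally show ?thesis using True by simp
  next
    case False
    have "y\<^sup>2 \<le> (x + y)\<^sup>2" using xy by (intro power_mono) auto
    also have "\<dots> \<le> (x + y) ^ q" using xy assms by (intro power_increasing) auto
    finally show ?thesis
      using xy assms False by (intro mult_mono power_increasing) auto
  qed
  thus "(case p of (a, b) \<Rightarrow> 1 / (real (Suc a) ^ j * (real (Suc a) + real (Suc b)) ^ q))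
      \<le> (case p of (a, b) \<Rightarrow> 1 / (real (Suc a) ^ 2 * real (Suc b) ^ 2))"
    unfolding p prod.case x_def[symmetric] y_def[symmetric]
    using xy by (intro divide_left_mono mult_pos_pos zero_less_power) auto
qed auto

lemma
  assumes "j \<ge> 1" "q \<ge> 2" "j + q \<ge> 4"
  shows has_sum_euler_sum:
      "((\<lambda>m. gen_harm (Suc m) j / real (Suc m) ^ q) has_sum euler_sum j q) UNIV"
    and has_sum_Tornheim: "((\<lambda>(a, b). 1 / (real (Suc a) ^ j * (real (Suc a) + real (Suc b)) ^ q))
           has_sum (euler_sum j q - zeta (j + q))) UNIV" (is "(?t has_sum _) _")
proof -
  define g where "g = (\<lambda>(m, k). 1 / (real (Suc k) ^ j * real (Suc m) ^ q))"
  define h where "h = (\<lambda>m. gen_harm m j / real (Suc m) ^ q)"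
  \<comment> \<open>Indices start at 0, so the sum of \<open>Suc a\<close> and \<open>Suc b\<close>
    is \<open>Suc m\<close> for \<open>m = Suc (a + b)\<close>. Positivity of \<open>Suc b\<close>
    becomes \<open>k < m\<close>; hence \<open>h\<close> contains \<open>gen_harm m\<close>, and the
    term \<open>k = m\<close> has to be added separately.\<close>
  have reindex: "(?t has_sum S) UNIV \<longleftrightarrow> (g has_sum S) (Sigma UNIV (\<lambda>m. {..<m}))" for S
    by (rule has_sum_reindex_bij_witness
        [of _ "\<lambda>(m, k). (k, m - Suc k)" "\<lambda>(a, b). (Suc (a + b), a)"])
       (auto simp: g_def add_ac)
  obtain S where S: "(?t has_sum S) UNIV"
    using summable_on_Tornheim[OF assms] by (auto simp: summable_on_def)
  have "(h has_sum S) UNIV"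
  proof (rule has_sum_SigmaD)
    show "(g has_sum S) (Sigma UNIV (\<lambda>m. {..<m}))" using S reindex by blast
    show "((\<lambda>k. g (m, k)) has_sum h m) {..<m}" for m
      using has_sum_finite[of "{..<m}" "\<lambda>k. g (m, k)"]
      by (simp add: g_def h_def gen_harm_lessThan sum_divide_distrib)
  qed
  moreover have "((\<lambda>m. 1 / real (Suc m) ^ (j + q)) has_sum zeta (j + q)) UNIV"
    using assms by (intro has_sum_zeta) auto
  ultimately have "((\<lambda>m. h m + 1 / real (Suc m) ^ (j + q)) has_sum S + zeta (j + q)) UNIV"
    by (rule has_sum_add)
  also have "(\<lambda>m. h m + 1 / real (Suc m) ^ (j + q)) = (\<lambda>m. gen_harm (Suc m) j / real (Suc m) ^ q)"
    by (simp add: h_def gen_harm_Suc add_divide_distrib power_add)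
  finally have harm: "((\<lambda>m. gen_harm (Suc m) j / real (Suc m) ^ q) has_sum S + zeta (j + q)) UNIV" .
  hence eq: "S + zeta (j + q) = euler_sum j q"
    unfolding euler_sum_def using has_sum_imp_sums sums_unique by blast
  show "((\<lambda>m. gen_harm (Suc m) j / real (Suc m) ^ q) has_sum euler_sum j q) UNIV"
    using harm unfolding eq .
  show "(?t has_sum (euler_sum j q - zeta (j + q))) UNIV"
    using S unfolding eq[symmetric] by simp
qed

section \<open>Splitting along the diagonal and the reflection formula\<close>

text \<open>Each open triangle is parametrized by its smaller coordinate and the gap. As
  \<open>Suc (Suc (a + b))\<close> equals \<open>Suc a + Suc b\<close>, the larger coordinate turns
  into a Tornheim denominator.\<close>

lemma has_sum_nat_prod_split:
  fixes f :: "nat \<times> nat \<Rightarrow> real"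
  assumes "((\<lambda>(a, b). f (a, Suc (a + b))) has_sum U) UNIV"
    and "((\<lambda>(a, b). f (Suc (a + b), a)) has_sum L) UNIV"
    and "((\<lambda>a. f (a, a)) has_sum D) UNIV"
  shows "(f has_sum U + L + D) UNIV"
proof -
  have "(f has_sum U) {(a, b). a < b}"
    by (rule iffD1[OF has_sum_reindex_bij_witness
        [of _ "\<lambda>(a, b). (a, b - Suc a)" "\<lambda>(a, b). (a, Suc (a + b))"] assms(1)]) auto
  moreover have "(f has_sum L) {(a, b). b < a}"
    by (rule iffD1[OF has_sum_reindex_bij_witness
        [of _ "\<lambda>(a, b). (b, a - Suc b)" "\<lambda>(a, b). (Suc (a + b), a)"] assms(2)]) auto
  ultimately have "(f has_sum U + L) ({(a, b). a < b} \<union> {(a, b). b < a})"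
    by (rule has_sum_Un_disjoint) auto
  moreover have "(f has_sum D) {(a, b). a = b}"
    by (rule iffD1[OF has_sum_reindex_bij_witness[of _ fst "\<lambda>a. (a, a)"] assms(3)]) auto
  ultimately have "(f has_sum U + L + D) ({(a, b). a < b} \<union> {(a, b). b < a} \<union> {(a, b). a = b})"
    by (rule has_sum_Un_disjoint) auto
  also have "{(a, b). a < b} \<union> {(a, b). b < a} \<union> {(a, b). a = b} = (UNIV :: (nat \<times> nat) set)"
    by auto
  finally show ?thesis .
qed

text \<open>The triangles of the product series are T(n, s) and T(s, n), the diagonal is
  \<open>zeta (n + s)\<close>. Two copies of \<open>zeta (n + s)\<close> subtracted and one added
  leave the single one.\<close>

lemma euler_sum_reflection:
  assumes "n \<ge> 2" "s \<ge> 2"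
  shows "euler_sum n s + euler_sum s n = zeta n * zeta s + zeta (n + s)"
proof -
  let ?f = "\<lambda>(a, b). 1 / (real (Suc a) ^ n * real (Suc b) ^ s)"
  have "(?f has_sum (euler_sum n s - zeta (n + s)) + (euler_sum s n - zeta (s + n)) + zeta (n + s)) UNIV"
    using assms has_sum_Tornheim[of n s] has_sum_Tornheim[of s n] has_sum_zeta[of "n + s"]
    by (intro has_sum_nat_prod_split) (simp_all add: case_prod_unfold power_add mult_ac add_ac)
  from has_sum_unique[OF this has_sum_zeta_mult[OF assms]] show ?thesis
    by (simp add: add.commute)
qed

section \<open>Euler's evaluation of the linear harmonic sums\<close>

text \<open>Raising \<open>a\<close> by one adds a telescoping series whose value is
  \<open>1 / (a + 1)\<close>.\<close>

lemma sums_gen_harm_1: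
  "(\<lambda>b. 1 / real (Suc b) - 1 / (real a + real (Suc b))) sums gen_harm a 1"
proof (induction a)
  case 0
  show ?case by (simp add: gen_harm_def)
next
  case (Suc a)
  have "(\<lambda>b. 1 / (real a + real (Suc b)) - 1 / (real a + real (Suc (Suc b)))) sums
      (1 / (real a + real (Suc 0)) - 0)"
  proof (rule telescope_sums')
    show "(\<lambda>b. 1 / (real a + real (Suc b))) \<longlonglongrightarrow> 0"
      using LIMSEQ_ignore_initial_segment[OF lim_1_over_n[where 'a = real], of "Suc a"]
      by (simp add: add_ac)
  qed
  from sums_add[OF Suc this] show ?case
    by (simp add: gen_harm_Suc add_ac)
qed

lemma has_sum_gen_harm_1:
  "((\<lambda>b. 1 / ((real (Suc a) + real (Suc b)) * real (Suc b))) has_sum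
     gen_harm (Suc a) 1 / real (Suc a)) UNIV"
proof (rule sums_nonneg_imp_has_sum)
  have "(1 / real (Suc b) - 1 / (real (Suc a) + real (Suc b))) / real (Suc a)
      = 1 / ((real (Suc a) + real (Suc b)) * real (Suc b))" for b
    by (simp add: divide_simps del: of_nat_Suc)
  thus "(\<lambda>b. 1 / ((real (Suc a) + real (Suc b)) * real (Suc b))) sums
      (gen_harm (Suc a) 1 / real (Suc a))"
    using sums_divide[OF sums_gen_harm_1[of "Suc a"], of "real (Suc a)"] by simp
qed auto

text \<open>Summing over \<open>b\<close> first produces \<open>gen_harm (Suc a) 1 / Suc a\<close>.
  Nonnegativity of the terms makes the double series unconditionally summable. It is the first
  boundary term of the geometric sum below.\<close>

lemma has_sum_euler_sum_1:
  "((\<lambda>(a, b). 1 / (real (Suc a) ^ (m + 2) * ((real (Suc a) + real (Suc b)) * real (Suc b))))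
     has_sum euler_sum 1 (m + 3)) UNIV" (is "(?f has_sum _) _")
proof -
  have outer: "((\<lambda>a. gen_harm (Suc a) 1 / real (Suc a) ^ (m + 3)) has_sum euler_sum 1 (m + 3)) UNIV"
    by (rule has_sum_euler_sum) auto
  have inner: "((\<lambda>b. ?f (a, b)) has_sum gen_harm (Suc a) 1 / real (Suc a) ^ (m + 3)) UNIV" for a
    using has_sum_cmult_right[OF has_sum_gen_harm_1[of a], of "1 / real (Suc a) ^ (m + 2)"]
    by (simp add: mult_ac power_add eval_nat_numeral del: of_nat_Suc)
  have "?f summable_on (UNIV \<times> UNIV)"
    by (rule summable_on_SigmaI[OF inner has_sum_imp_summable[OF outer]]) auto
  hence "(?f has_sum euler_sum 1 (m + 3)) (UNIV \<times> UNIV)"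
    by (rule has_sum_SigmaI[OF inner outer])
  thus ?thesis by simp
qed

text \<open>A finite geometric sum in which \<open>D\<close> stands for
  \<open>x * y / (x - y)\<close>, so that no division occurs. For \<open>x = 1 / a\<close> and
  \<open>y = 1 / (a + b)\<close> this \<open>D\<close> is \<open>1 / b\<close>.\<close>

lemma geometric_partial_fractions:
  fixes x y D :: "'a :: comm_ring_1"
  assumes "(x - y) * D = x * y"
  shows "(\<Sum>i=2..m+2. x ^ i * y ^ (m + 4 - i)) = (x ^ (m + 2) * y - x * y ^ (m + 2)) * D"
proof (induction m)
  case 0
  have "(x\<^sup>2 * y - x * y\<^sup>2) * D = x * y * ((x - y) * D)"
    by (simp add: algebra_simps power2_eq_square)
  also have "\<dots> = x * y * (x * y)"
    unfolding assms ..
  finally show ?case by (simp add: power2_eq_square mult_ac)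
next
  case (Suc m)
  have "(\<Sum>i=2..m+2. x ^ i * y ^ (Suc m + 4 - i)) = y * (\<Sum>i=2..m+2. x ^ i * y ^ (m + 4 - i))"
    unfolding sum_distrib_left
  proof (intro sum.cong refl)
    fix i assume "i \<in> {2..m+2}"
    hence "Suc m + 4 - i = Suc (m + 4 - i)" by auto
    thus "x ^ i * y ^ (Suc m + 4 - i) = y * (x ^ i * y ^ (m + 4 - i))"
      by (simp only: power_Suc mult_ac)
  qed
  hence "(\<Sum>i=2..Suc m+2. x ^ i * y ^ (Suc m + 4 - i))
      = y * ((x ^ (m + 2) * y - x * y ^ (m + 2)) * D) + x ^ (m + 2) * y * (x * y)"
    using Suc by (simp add: power2_eq_square mult_ac)
  also have "\<dots> = (x ^ (Suc m + 2) * y - x * y ^ (Suc m + 2)) * D"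
    unfolding assms[symmetric] by (simp add: algebra_simps)
  finally show ?case .
qed

text \<open>
  For $a < b$ the sum over $i$ of $a^{-i} b^{-(m+4-i)}$ is geometric; its two boundary terms sum to
  the Euler sum itself and to $2 T(1, m + 3)$.
\<close>
lemma euler_linear_sum:
  "2 * euler_sum 1 (m + 3)
     = real (m + 5) * zeta (m + 4) - (\<Sum>i=2..m+2. zeta i * zeta (m + 4 - i))"
proof -
  define f where "f = (\<lambda>(a, b). \<Sum>i=2..m+2. 1 / (real (Suc a) ^ i * real (Suc b) ^ (m + 4 - i)))"
  define E where "E = euler_sum 1 (m + 3)"
  define T where "T = E - zeta (m + 4)"
  have "((\<lambda>p. \<Sum>i=2..m+2. (case p of (a, b) \<Rightarrow> 1 / (real (Suc a) ^ i * real (Suc b) ^ (m + 4 - i))))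
      has_sum (\<Sum>i=2..m+2. zeta i * zeta (m + 4 - i))) UNIV"
    by (intro has_sum_finite_sum has_sum_zeta_mult) auto
  hence total: "(f has_sum (\<Sum>i=2..m+2. zeta i * zeta (m + 4 - i))) UNIV"
    by (simp add: f_def case_prod_unfold)
  \<comment> \<open>Reversing the order of summation exchanges the exponents, so the lower triangle
    needs no evaluation of its own.\<close>
  have f_sym: "f (b, a) = f (a, b)" for a b
    unfolding f_def prod.case
    by (rule sum.reindex_bij_witness[of _ "\<lambda>i. m + 4 - i" "\<lambda>i. m + 4 - i"]) (auto simp: mult.commute)
  have Tornheim: "((\<lambda>(a, b). 1 / (real (Suc a) ^ 1 * (real (Suc a) + real (Suc b)) ^ (m + 3)))
      has_sum T) UNIV"
    using has_sum_Tornheim[of 1 "m + 3"] by (simp add: T_def E_def add_ac)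
  have Tornheim': "((\<lambda>(a, b). 1 / (real (Suc b) ^ 1 * (real (Suc b) + real (Suc a)) ^ (m + 3)))
      has_sum T) UNIV"
    by (rule has_sum_UNIV_swap[OF Tornheim])
  have f_upper: "f (a, Suc (a + b)) =
      1 / (real (Suc a) ^ (m + 2) * ((real (Suc a) + real (Suc b)) * real (Suc b)))
      - 1 / (real (Suc a) ^ 1 * (real (Suc a) + real (Suc b)) ^ (m + 3))
      - 1 / (real (Suc b) ^ 1 * (real (Suc b) + real (Suc a)) ^ (m + 3))" for a b
  proof -
    define x y where "x = real (Suc a)" and "y = real (Suc b)"
    have pos: "x > 0" "y > 0" by (simp_all add: x_def y_def)
    have "f (a, Suc (a + b)) = (\<Sum>i=2..m+2. (1 / x) ^ i * (1 / (x + y)) ^ (m + 4 - i))"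
      by (simp add: f_def x_def y_def power_divide add_ac)
    also have "\<dots> = ((1 / x) ^ (m + 2) * (1 / (x + y)) - 1 / x * (1 / (x + y)) ^ (m + 2)) * (1 / y)"
      using pos by (intro geometric_partial_fractions) (simp add: divide_simps)
    also have "\<dots> = 1 / (x ^ (m + 2) * ((x + y) * y)) - 1 / (x + y) ^ (m + 2) * (1 / (x * y))"
      by (simp add: algebra_simps power_divide)
    \<comment> \<open>This splits the second boundary term into two Tornheim terms that are mirror
      images in \<open>x\<close> and \<open>y\<close>.\<close>
    also have "1 / (x * y) = (1 / x + 1 / y) * (1 / (x + y))"
      using pos by (simp add: divide_simps)
    also have "1 / (x + y) ^ (m + 2) * \<dots> = 1 / (x ^ 1 * (x + y) ^ (m + 3)) + 1 / (y ^ 1 * (y + x) ^ (m + 3))"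
    proof -
      have "1 / z ^ (m + 2) * ((1 / x + 1 / y) * (1 / z)) = 1 / (x ^ 1 * z ^ (m + 3)) + 1 / (y ^ 1 * z ^ (m + 3))" for z
        by (simp add: distrib_left distrib_right eval_nat_numeral mult_ac)
      thus ?thesis by (simp only: add.commute[of y x])
    qed
    finally show ?thesis unfolding x_def y_def by simp
  qed
  have upper: "((\<lambda>(a, b). f (a, Suc (a + b))) has_sum E - T - T) UNIV"
    using has_sum_diff[OF has_sum_diff[OF has_sum_euler_sum_1[of m] Tornheim] Tornheim']
    unfolding f_upper E_def by (simp add: case_prod_unfold)
  hence lower: "((\<lambda>(a, b). f (Suc (a + b), a)) has_sum E - T - T) UNIV"
    by (simp add: f_sym)
  \<comment> \<open>On the diagonal all \<open>m + 1\<close> summands coincide.\<close>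
  have "f (a, a) = real (m + 1) * (1 / real (Suc a) ^ (m + 4))" for a
  proof -
    have "f (a, a) = (\<Sum>i=2..m+2. 1 / real (Suc a) ^ (m + 4))"
      unfolding f_def prod.case power_add[symmetric] by (intro sum.cong refl) auto
    thus ?thesis by simp
  qed
  hence diag: "((\<lambda>a. f (a, a)) has_sum real (m + 1) * zeta (m + 4)) UNIV"
    using has_sum_cmult_right[OF has_sum_zeta[of "m + 4"], of "real (m + 1)"] by simp
  \<comment> \<open>Each triangle contributes \<open>E - 2 * T = 2 * zeta (m + 4) - E\<close>; with
    the \<open>m + 1\<close> diagonal copies this gives the factor \<open>m + 5\<close>.\<close>
  from has_sum_unique[OF total has_sum_nat_prod_split[OF upper lower diag]]
  show ?thesis by (simp add: E_def T_def algebra_simps)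
qed

section \<open>Partial fractions for products of powers\<close>

text \<open>One half of the partial fraction expansion of \<open>x ^ Suc n * y ^ Suc s\<close>, with
  \<open>x\<close>, \<open>y\<close>, \<open>z\<close> in the roles of 1/a, 1/b, 1/(a + b). The
  exponents are shifted by one so that the recursion starts at \<open>n = s = 0\<close>.\<close>

definition shuffle_sum :: "'a :: comm_ring_1 \<Rightarrow> 'a \<Rightarrow> nat \<Rightarrow> nat \<Rightarrow> 'a" where
  "shuffle_sum z x n s = (\<Sum>j\<le>n. of_nat ((n + s - j) choose s) * (z ^ (Suc (n + s) - j) * x ^ Suc j))"

lemma shuffle_sum_0: "shuffle_sum z x 0 s = z ^ Suc s * x"
  by (simp add: shuffle_sum_def)

lemma shuffle_sum_Suc_0: "shuffle_sum z x (Suc n) 0 = z * (shuffle_sum z x n 0 + x ^ Suc (Suc n))"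
proof -
  have "(\<Sum>j\<le>n. z ^ (Suc (Suc n) - j) * x ^ Suc j) = z * (\<Sum>j\<le>n. z ^ (Suc n - j) * x ^ Suc j)"
    unfolding sum_distrib_left by (intro sum.cong refl) (simp add: Suc_diff_le mult_ac)
  thus ?thesis by (simp add: shuffle_sum_def algebra_simps)
qed

text \<open>Pascal's rule applied to each coefficient with \<open>j \<le> n\<close>.\<close>

lemma shuffle_sum_Suc_Suc:
  "shuffle_sum z x (Suc n) (Suc s) = z * (shuffle_sum z x n (Suc s) + shuffle_sum z x (Suc n) s)"
proof -
  have "of_nat ((Suc n + Suc s - j) choose Suc s) * (z ^ (Suc (Suc n + Suc s) - j) * x ^ Suc j)
      = z * (of_nat ((n + Suc s - j) choose Suc s) * (z ^ (Suc (n + Suc s) - j) * x ^ Suc j)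
           + of_nat ((Suc n + s - j) choose s) * (z ^ (Suc (Suc n + s) - j) * x ^ Suc j))"
    if "j \<in> {..n}" for j
  proof -
    \<comment> \<open>Writing \<open>n\<close> as \<open>j + k\<close> eliminates truncated
      subtraction.\<close>
    from that obtain k where n: "n = j + k" using le_Suc_ex by auto
    have e: "Suc n + Suc s - j = Suc (Suc (k + s))" "n + Suc s - j = Suc (k + s)"
      "Suc n + s - j = Suc (k + s)" "Suc (Suc n + Suc s) - j = Suc (Suc (Suc (k + s)))"
      "Suc (n + Suc s) - j = Suc (Suc (k + s))" "Suc (Suc n + s) - j = Suc (Suc (k + s))"
      by (simp_all add: n)
    show ?thesis
      unfolding e binomial_Suc_Suc[of "Suc (k + s)" s] power_Suc[of z "Suc (Suc (k + s))"] of_nat_add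
      by (simp only: distrib_left distrib_right mult_ac add_ac)
  qed
  hence "(\<Sum>j\<le>n. of_nat ((Suc n + Suc s - j) choose Suc s) * (z ^ (Suc (Suc n + Suc s) - j) * x ^ Suc j))
      = z * ((\<Sum>j\<le>n. of_nat ((n + Suc s - j) choose Suc s) * (z ^ (Suc (n + Suc s) - j) * x ^ Suc j))
           + (\<Sum>j\<le>n. of_nat ((Suc n + s - j) choose s) * (z ^ (Suc (Suc n + s) - j) * x ^ Suc j)))"
    unfolding sum.distrib[symmetric] sum_distrib_left by (intro sum.cong refl)
  \<comment> \<open>The top index \<open>j = Suc n\<close> occurs only in the second sum on the
    right; its binomial coefficient is 1 on both sides.\<close>
  moreover have "Suc n + Suc s - Suc n = Suc s" "Suc n + s - Suc n = s"
    "Suc (Suc n + Suc s) - Suc n = Suc (Suc s)" "Suc (Suc n + s) - Suc n = Suc s"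
    by simp_all
  ultimately show ?thesis
    unfolding shuffle_sum_def sum.atMost_Suc
    by (simp only: binomial_n_n power_Suc[of z "Suc s"] distrib_left of_nat_1 mult_1_left mult.assoc add.assoc)
qed

text \<open>The hypothesis is 1/(ab) = (1/a + 1/b)/(a + b) in ring form. Using it on one factor
  \<open>x * y\<close> lowers either exponent by one, which is the recursion satisfied by
  \<open>shuffle_sum\<close>. When an exponent is 1, a pure power appears instead, matching
  \<open>shuffle_sum_Suc_0\<close>.\<close>

lemma partial_fractions_shuffle:
  fixes x y z :: "'a :: comm_ring_1"
  assumes "x * y = z * (x + y)"
  shows "x ^ Suc n * y ^ Suc s = shuffle_sum z x n s + shuffle_sum z y s n"
proof (induction n arbitrary: s)
  case 0
  show ?case
  proof (induction s)
    case 0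
    show ?case using assms by (simp add: shuffle_sum_0 distrib_left)
  next
    case (Suc s)
    have "x ^ Suc 0 * y ^ Suc (Suc s) = y ^ Suc s * (x * y)"
      by (simp add: mult_ac)
    also have "\<dots> = z * (x ^ Suc 0 * y ^ Suc s + y ^ Suc (Suc s))"
      unfolding assms by (simp add: algebra_simps)
    finally show ?case
      unfolding Suc by (simp add: shuffle_sum_0 shuffle_sum_Suc_0 algebra_simps)
  qed
next
  case (Suc n)
  note outer = Suc.IH
  show ?case
  proof (induction s)
    case 0
    have "x ^ Suc (Suc n) * y ^ Suc 0 = x ^ Suc n * (x * y)"
      by (simp add: mult_ac)
    also have "\<dots> = z * (x ^ Suc n * y ^ Suc 0 + x ^ Suc (Suc n))"
      unfolding assms by (simp add: algebra_simps)
    finally show ?case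
      unfolding outer by (simp add: shuffle_sum_0 shuffle_sum_Suc_0 algebra_simps)
  next
    case (Suc s)
    have "x ^ Suc (Suc n) * y ^ Suc (Suc s) = x ^ Suc n * y ^ Suc s * (x * y)"
      by (simp add: mult_ac)
    also have "\<dots> = z * (x ^ Suc n * y ^ Suc (Suc s) + x ^ Suc (Suc n) * y ^ Suc s)"
      unfolding assms by (simp add: algebra_simps)
    finally show ?case
      unfolding outer Suc by (simp add: shuffle_sum_Suc_Suc algebra_simps)
  qed
qed

lemma shuffle_sum_inverse:
  assumes "n \<ge> 1" "s \<ge> 1"
  shows "shuffle_sum (1 / z) (1 / x) (n - 1) (s - 1)
     = (\<Sum>i=1..n. real ((n + s - i - 1) choose (s - 1)) * (1 / (x ^ i * z ^ (n + s - i))))"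
  unfolding shuffle_sum_def
  by (rule sum.reindex_bij_witness[of _ "\<lambda>i. i - 1" Suc])
     (use assms in \<open>auto simp: power_divide mult.commute diff_diff_left add.commute simp del: power_Suc\<close>)

section \<open>Summing the partial fractions over all pairs\<close>

text \<open>The hockey-stick identity in reversed order; it yields the total weight of
  \<open>zeta (n + s)\<close> in the shuffle formula.\<close>

lemma sum_choose_diag: "(\<Sum>j\<le>n. (n + s - j) choose s) = Suc (n + s) choose Suc s"
proof -
  have "(\<Sum>j\<le>n. (n + s - j) choose s) = (\<Sum>k\<le>n. (s + k) choose s)"
    by (rule sum.reindex_bij_witness[of _ "\<lambda>k. n - k" "\<lambda>k. n - k"]) (auto simp: add_ac)
  also have "\<dots> = Suc (n + s) choose Suc s"
    by (induction n) (simp_all add: add_ac)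
  finally show ?thesis .
qed

text \<open>The expansion is summed termwise. Every term converges by itself:
  \<open>n + s - i\<close> is at least \<open>s\<close> for \<open>i \<le> n\<close> and at least
  \<open>n\<close> for \<open>i \<le> s\<close>, hence at least 2. Exchanging \<open>a\<close> and
  \<open>b\<close> does not change a sum.\<close>

lemma zeta_mult_shuffle:
  assumes "n \<ge> 2" and "s \<ge> 2"
  shows "zeta n * zeta s =
       (\<Sum>i=1..n. real ((n + s - i - 1) choose (s - 1)) * (euler_sum i (n + s - i) - zeta (n + s)))
     + (\<Sum>i=1..s. real ((n + s - i - 1) choose (n - 1)) * (euler_sum i (n + s - i) - zeta (n + s)))"
proof -
  let ?c = "\<lambda>i. real ((n + s - i - 1) choose (s - 1))"
  let ?d = "\<lambda>i. real ((n + s - i - 1) choose (n - 1))"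
  let ?t = "\<lambda>i (a :: nat, b :: nat). 1 / (real (Suc a) ^ i * (real (Suc a) + real (Suc b)) ^ (n + s - i))"
  let ?t' = "\<lambda>i (a :: nat, b :: nat). 1 / (real (Suc b) ^ i * (real (Suc b) + real (Suc a)) ^ (n + s - i))"
  have t: "(?t i has_sum (euler_sum i (n + s - i) - zeta (n + s))) UNIV"
    if "i \<in> {1..n} \<or> i \<in> {1..s}" for i
    using that assms has_sum_Tornheim[of i "n + s - i"] by auto
  have t': "(?t' i has_sum (euler_sum i (n + s - i) - zeta (n + s))) UNIV"
    if "i \<in> {1..s}" for i
    by (rule has_sum_UNIV_swap[OF t]) (use that in simp)
  have sum: "((\<lambda>p. (\<Sum>i=1..n. ?c i * ?t i p) + (\<Sum>i=1..s. ?d i * ?t' i p)) has_sum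
        (\<Sum>i=1..n. ?c i * (euler_sum i (n + s - i) - zeta (n + s)))
      + (\<Sum>i=1..s. ?d i * (euler_sum i (n + s - i) - zeta (n + s)))) UNIV"
    by (intro has_sum_add has_sum_finite_sum has_sum_cmult_right t t') auto
  have "(\<Sum>i=1..n. ?c i * ?t i (a, b)) + (\<Sum>i=1..s. ?d i * ?t' i (a, b))
      = 1 / (real (Suc a) ^ n * real (Suc b) ^ s)" for a b
  proof -
    define x y where "x = real (Suc a)" and "y = real (Suc b)"
    have pos: "x > 0" "y > 0" by (simp_all add: x_def y_def)
    have "1 / (x ^ n * y ^ s) = (1 / x) ^ Suc (n - 1) * (1 / y) ^ Suc (s - 1)"
      using assms by (simp add: power_divide del: power_Suc)
    also have "\<dots> = shuffle_sum (1 / (x + y)) (1 / x) (n - 1) (s - 1)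
                  + shuffle_sum (1 / (x + y)) (1 / y) (s - 1) (n - 1)"
      using pos by (intro partial_fractions_shuffle) (simp add: divide_simps)
    also have "\<dots> = (\<Sum>i=1..n. ?c i * (1 / (x ^ i * (x + y) ^ (n + s - i))))
                  + (\<Sum>i=1..s. ?d i * (1 / (y ^ i * (y + x) ^ (n + s - i))))"
      using assms shuffle_sum_inverse[of n s "x + y" x] shuffle_sum_inverse[of s n "x + y" y]
      by (simp add: add.commute)
    finally show ?thesis unfolding x_def y_def by simp
  qed
  hence "((\<lambda>(a, b). 1 / (real (Suc a) ^ n * real (Suc b) ^ s)) has_sum
        (\<Sum>i=1..n. ?c i * (euler_sum i (n + s - i) - zeta (n + s)))
      + (\<Sum>i=1..s. ?d i * (euler_sum i (n + s - i) - zeta (n + s)))) UNIV"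
    using sum by (simp add: case_prod_unfold)
  from has_sum_unique[OF has_sum_zeta_mult[OF assms] this] show ?thesis .
qed

section \<open>Removal of the extreme terms from the shuffle formula\<close>

theorem theorem5p19:
  fixes n s :: nat
  assumes "n \<ge> 2" and "s \<ge> 2"
  shows "(\<Sum>i=2..n-1. real ((n + s - i - 1) choose (s - 1)) * euler_sum i (n + s - i))
       + (\<Sum>i=2..s-1. real ((n + s - i - 1) choose (n - 1)) * euler_sum i (n + s - i))
       = zeta (n + s) * (real ((n + s) choose n)
            - real (n + s + 1) * real ((n + s - 2) choose (s - 1)) - 1)
       + real ((n + s - 2) choose (s - 1)) * (\<Sum>i=2..n+s-2. zeta i * zeta (n + s - i))"
proof -
  let ?c = "\<lambda>i. real ((n + s - i - 1) choose (s - 1))"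
  let ?d = "\<lambda>i. real ((n + s - i - 1) choose (n - 1))"
  let ?E = "\<lambda>i. euler_sum i (n + s - i)"
  define Z where "Z = zeta (n + s)"
  define C where "C = real ((n + s - 2) choose (s - 1))"
  \<comment> \<open>Both families have the same coefficient at \<open>i = 1\<close>.\<close>
  have C': "C = real ((n + s - 2) choose (n - 1))"
    unfolding C_def using assms binomial_symmetric[of "s - 1" "n + s - 2"]
    by (simp add: numeral_2_eq_2)
  \<comment> \<open>For \<open>m = 2\<close> the middle sum is empty.\<close>
  have split: "(\<Sum>i=1..m. f i) = f 1 + (\<Sum>i=2..m-1. f i) + f m" if "m \<ge> 2" for m and f :: "nat \<Rightarrow> real"
  proof -
    from le_Suc_ex[OF that] obtain k where "m = Suc (Suc k)" by auto
    thus ?thesis using sum.atLeast_Suc_atMost[of 1 "Suc k" f] by (simp add: numeral_2_eq_2)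
  qed
  \<comment> \<open>Stated for fresh \<open>n\<close> and \<open>s\<close> because it is applied in
    both orders.\<close>
  have choose_sum: "(\<Sum>i=1..n. real ((n + s - i - 1) choose (s - 1))) = real ((n + s - 1) choose s)"
    if "n \<ge> 1" "s \<ge> 1" for n s :: nat
  proof -
    have "(\<Sum>i=1..n. real ((n + s - i - 1) choose (s - 1)))
        = (\<Sum>j\<le>n-1. real ((n - 1 + (s - 1) - j) choose (s - 1)))"
      by (rule sum.reindex_bij_witness[of _ Suc "\<lambda>i. i - 1"]) (use that in auto)
    also have "\<dots> = real ((n + s - 1) choose s)"
    proof -
      have "Suc (n - 1 + (s - 1)) = n + s - 1" "Suc (s - 1) = s" using that by auto
      thus ?thesis
        using sum_choose_diag[of "n - 1" "s - 1"] unfolding of_nat_sum[symmetric] by (simp only:)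
    qed
    finally show ?thesis .
  qed
  \<comment> \<open>By symmetry and Pascal's rule the weights of \<open>zeta (n + s)\<close> add up
    to the binomial coefficient in the bracket of the claim.\<close>
  have "(\<Sum>i=1..n. ?c i) + (\<Sum>i=1..s. ?d i) = real ((n + s - 1) choose s) + real ((n + s - 1) choose n)"
    using choose_sum[of n s] choose_sum[of s n] assms by (simp add: add.commute)
  also have "(n + s - 1) choose n = (n + s - 1) choose (s - 1)"
    using assms binomial_symmetric[of n "n + s - 1"] by simp
  also have "real ((n + s - 1) choose s) + real ((n + s - 1) choose (s - 1)) = real ((n + s) choose s)"
    using assms by (cases s) (simp_all add: add_ac)
  also have "(n + s) choose s = (n + s) choose n"
    using binomial_symmetric[of s "n + s"] by simp
  finally have coeffs: "(\<Sum>i=1..n. ?c i) + (\<Sum>i=1..s. ?d i) = real ((n + s) choose n)" .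
  have "zeta n * zeta s + real ((n + s) choose n) * Z = (\<Sum>i=1..n. ?c i * ?E i) + (\<Sum>i=1..s. ?d i * ?E i)"
    unfolding zeta_mult_shuffle[OF assms] coeffs[symmetric] Z_def
    by (simp add: right_diff_distrib sum_subtractf sum_distrib_right distrib_right)
  \<comment> \<open>The last coefficient is 1, so the term \<open>i = n\<close> is
    \<open>euler_sum n s\<close>; likewise \<open>i = s\<close> gives \<open>euler_sum s n\<close>
    in the other family.\<close>
  also have "(\<Sum>i=1..n. ?c i * ?E i) = C * euler_sum 1 (n + s - 1) + (\<Sum>i=2..n-1. ?c i * ?E i) + euler_sum n s"
    using assms by (subst split) (simp_all add: C_def numeral_2_eq_2)
  also have "(\<Sum>i=1..s. ?d i * ?E i) = C * euler_sum 1 (n + s - 1) + (\<Sum>i=2..s-1. ?d i * ?E i) + euler_sum s n"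
    using assms by (subst split) (simp_all add: C' numeral_2_eq_2)
  finally have main: "(\<Sum>i=2..n-1. ?c i * ?E i) + (\<Sum>i=2..s-1. ?d i * ?E i)
      = zeta n * zeta s + real ((n + s) choose n) * Z - (euler_sum n s + euler_sum s n)
        - C * (2 * euler_sum 1 (n + s - 1))"
    by simp
  obtain m where m: "n + s = m + 4"
    using assms le_Suc_ex[of 4 "n + s"] by (auto simp: add.commute)
  have euler: "2 * euler_sum 1 (n + s - 1)
      = real (n + s + 1) * Z - (\<Sum>i=2..n+s-2. zeta i * zeta (n + s - i))"
    using euler_linear_sum[of m] unfolding Z_def m by (simp add: add_ac)
  show ?thesis
    \<comment> \<open>Reflection cancels \<open>zeta n * zeta s\<close> and leaves
      \<open>- Z\<close>, the \<open>- 1\<close> in the bracket; Euler's evaluation, multiplied by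
      \<open>C\<close>, supplies the term with \<open>n + s + 1\<close> and the sum of zeta
      products.\<close>
    unfolding main euler euler_sum_reflection[OF assms]
    unfolding Z_def[symmetric] C_def[symmetric]
    by (simp add: algebra_simps)
qed

end
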